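(* Let $n,\Delta$ be integers with $n\ge \Delta+1\ge 4$. Then $$\sigma_{\max}(n,\Delta)=\max_{\mathbf d\in\mathcal D_n^\Delta}\Big[F(\mathbf d)-2\,M_2^{\min}(\mathbf d)\Big].$$
   Context: All trees are finite. For a tree $T$, $d(v)$ is the degree of $v$, $\sigma(T)=\sum_{uv\in E(T)}(d(u)-d(v))^2$, and $M_2(T)=\sum_{uv\in E(T)}d(u)d(v)$ (second Zagreb index). $\sigma_{\max}(n,\Delta)$ is the maximum of $\sigma(T)$ over all trees $T$ on $n$ vertices with maximum degree exactly $\Delta$. $\mathcal D_n^\Delta$ is the set of integer sequences $\mathbf d=(d_1,\dots,d_n)$ with $1\le d_i\le \Delta$ for all $i$ and $\max_i d_i=\Delta$ that are realized as the degree sequence of at least one tree (equivalently, additionally $\sum_i d_i=2(n-1)$). For $\mathbf d\in\mathcal D_n^\Delta$, $F(\mathbf d)=\sum_{i=1}^n d_i^3$, $\mathcal R(\mathbf d)$ is the set of trees on $n$ labeled vertices realizing $\mathbf d$, and $M_2^{\min}(\mathbf d)=\min_{T\in\mathcal R(\mathbf d)}M_2(T)$. *)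

theory Defs
  imports "Graph_Theory.Graph_Theory"
begin

text \<open>
  A finite simple graph is a \<^locale>\<open>pair_graph\<close>: a finite vertex set with a symmetric irreflexive
  set of arcs. The library predicate \<^const>\<open>tree\<close> cannot be used on such graphs, because
  \<^const>\<open>forest\<close> forbids directed cycles and every undirected edge gives the directed cycle
  \<open>u, v, u\<close> of length 2. The cycles of the undirected graph are the directed cycles of length
  at least 3. Connectedness includes that there is at least one vertex.
\<close>

definition undirected_tree :: "'a pair_pre_digraph \<Rightarrow> bool" where
  "undirected_tree T \<longleftrightarrow>
     pair_graph T \<and> connected (with_proj T) \<and>
     \<not> (\<exists>p. pre_digraph.cycle (with_proj T) p \<and> 3 \<le> length p)"

text \<open>In a symmetric digraph the out-degree is the number of neighbours.\<close>

definition deg :: "'a pair_pre_digraph \<Rightarrow> 'a \<Rightarrow> int" where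
  "deg T v = int (out_degree (with_proj T) v)"

definition max_deg :: "'a pair_pre_digraph \<Rightarrow> int" where
  "max_deg T = Max (deg T ` pverts T)"

text \<open>Each undirected edge \<open>uv\<close> is represented once, by the arc \<open>(u, v)\<close> with \<open>u < v\<close>.\<close>

definition edges :: "'a::linorder pair_pre_digraph \<Rightarrow> ('a \<times> 'a) set" where
  "edges T = {(u, v) \<in> parcs T. u < v}"

definition sigma :: "'a::linorder pair_pre_digraph \<Rightarrow> int" where
  "sigma T = (\<Sum>(u, v)\<in>edges T. (deg T u - deg T v)\<^sup>2)"

definition M2 :: "'a::linorder pair_pre_digraph \<Rightarrow> int" where
  "M2 T = (\<Sum>(u, v)\<in>edges T. deg T u * deg T v)"

text \<open>
  Every finite tree is isomorphic to one whose vertices are natural numbers, so it suffices to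
  let \<open>T\<close> range over these; the vertex set is an arbitrary set of \<open>n\<close> naturals. There are
  infinitely many such \<open>T\<close>, but only finitely many values \<open>sigma T\<close>.
\<close>

definition sigma_max :: "nat \<Rightarrow> nat \<Rightarrow> int" where
  "sigma_max n \<Delta> =
     Max (sigma ` {T :: nat pair_pre_digraph.
                     undirected_tree T \<and> card (pverts T) = n \<and> max_deg T = int \<Delta>})"

text \<open>The \<open>n\<close> labelled vertices are \<open>0, \<dots>, n - 1\<close> for \<open>n = length d\<close>, and vertex \<open>i\<close> has degree \<open>d ! i\<close>.\<close>

definition realizations :: "int list \<Rightarrow> nat pair_pre_digraph set" where
  "realizations d =
     {T. undirected_tree T \<and> pverts T = {..<length d} \<and> (\<forall>i<length d. deg T i = d ! i)}"

definition tree_degree_sequences :: "nat \<Rightarrow> nat \<Rightarrow> int list set" where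
  "tree_degree_sequences n \<Delta> =
     {d. length d = n \<and> (\<forall>i<n. 1 \<le> d ! i \<and> d ! i \<le> int \<Delta>) \<and> Max (set d) = int \<Delta> \<and>
         realizations d \<noteq> {}}"

definition F :: "int list \<Rightarrow> int" where
  "F d = (\<Sum>i<length d. (d ! i) ^ 3)"

definition M2_min :: "int list \<Rightarrow> int" where
  "M2_min d = Min (M2 ` realizations d)"

end

theory Submission
  imports Defs
begin

text \<open>
  Expanding \<open>(d(u) - d(v))\<^sup>2 = d(u)\<^sup>2 + d(v)\<^sup>2 - 2 d(u) d(v)\<close> and summing over the edges, each
  vertex \<open>v\<close> contributes \<open>d(v)\<^sup>2\<close> once for each of its \<open>d(v)\<close> edges. Hence
  \<open>\<sigma>(T) = \<Sum>\<^sub>v d(v)\<^sup>3 - 2 M\<^sub>2(T)\<close> (lemma \<open>sigma_eq_sum_cubes_minus_M2\<close>), where the first summand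
  depends only on the degree sequence. Among the trees with a given degree sequence \<open>d\<close>, the largest
  \<open>\<sigma>\<close> is therefore attained where \<open>M\<^sub>2\<close> is smallest (lemma \<open>Max_sigma_realizations\<close>), and the maximum over all trees is taken in two stages:
  first over the trees with a fixed degree sequence, then over the degree sequences.

  The trees in the definition of \<open>sigma_max\<close> have arbitrary sets of \<open>n\<close> naturals as vertex sets, whereas
  realizations of degree sequences live on \<open>{0, \<dots>, n - 1}\<close>. Relabelling the vertices along a
  bijection is an isomorphism of digraphs, so it preserves trees, degrees and \<open>\<sigma>\<close>
  (lemma \<open>sigma_image_standard_vertices\<close>). On the fixed vertex set only finitely many trees remain,
  so that maxima and minima over them are attained.
\<close>

section \<open>Sums over edges\<close>

lemma sum_arcs_eq_sum_edges:
  fixes g :: "'a::linorder \<Rightarrow> 'a \<Rightarrow> int"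
  assumes "pair_graph T"
  shows "(\<Sum>(u, v)\<in>parcs T. g u v) = (\<Sum>(u, v)\<in>edges T. g u v + g v u)"
proof -
  interpret pair_graph T by fact
  have split: "parcs T = edges T \<union> prod.swap ` edges T"
  proof (intro set_eqI iffI)
    fix e assume e: "e \<in> parcs T"
    obtain u v where uv: "e = (u, v)" by (cases e)
    have "(v, u) \<in> parcs T" "u \<noteq> v"
      using e uv arcs_symmetric no_loops' by auto
    then show "e \<in> edges T \<union> prod.swap ` edges T"
      using e uv by (cases "u < v") (auto simp: edges_def image_iff)
  qed (auto simp: edges_def intro: arcs_symmetric)
  have fin: "finite (edges T)"
    by (rule finite_subset[OF _ pair_finite_arcs]) (auto simp: edges_def)
  have "(\<Sum>(u, v)\<in>parcs T. g u v) = (\<Sum>(u, v)\<in>edges T. g u v) + (\<Sum>(u, v)\<in>prod.swap ` edges T. g u v)"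
    unfolding split using fin by (intro sum.union_disjoint) (auto simp: edges_def)
  also have "(\<Sum>(u, v)\<in>prod.swap ` edges T. g u v) = (\<Sum>(u, v)\<in>edges T. g v u)"
    by (subst sum.reindex) (auto simp: case_prod_beta)
  finally show ?thesis
    by (simp add: sum.distrib case_prod_beta)
qed

lemma sum_arcs_tail_eq_sum_deg:
  assumes "pair_graph T"
  shows "(\<Sum>(u, v)\<in>parcs T. h u) = (\<Sum>u\<in>pverts T. deg T u * h u)"
proof -
  interpret pair_graph T by fact
  have "(\<Sum>e\<in>parcs T. h (fst e)) = (\<Sum>u\<in>pverts T. \<Sum>e\<in>{e \<in> parcs T. fst e = u}. h (fst e))"
    by (intro sum.group[symmetric] pair_finite_arcs pair_finite_verts) (auto dest: in_arcsD1)
  also have "\<dots> = (\<Sum>u\<in>pverts T. deg T u * h u)"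
    by (intro sum.cong refl) (simp add: deg_def out_degree_def out_arcs_def)
  finally show ?thesis by (simp add: case_prod_beta)
qed

text \<open>
  The squares \<open>d(u)\<^sup>2 + d(v)\<^sup>2\<close> over all edges are the squares of the tail degrees over all arcs,
  and \<open>v\<close> is the tail of \<open>d(v)\<close> arcs.
\<close>

lemma sigma_eq_sum_cubes_minus_M2:
  assumes "pair_graph T"
  shows "sigma T = (\<Sum>v\<in>pverts T. deg T v ^ 3) - 2 * M2 T"
proof -
  have "sigma T = (\<Sum>(u, v)\<in>edges T. (deg T u)\<^sup>2 + (deg T v)\<^sup>2) - 2 * M2 T"
    unfolding sigma_def M2_def sum_distrib_left sum_subtractf[symmetric]
    by (intro sum.cong) (auto simp: power2_diff)
  also have "(\<Sum>(u, v)\<in>edges T. (deg T u)\<^sup>2 + (deg T v)\<^sup>2) = (\<Sum>(u, v)\<in>parcs T. (deg T u)\<^sup>2)"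
    by (rule sum_arcs_eq_sum_edges[OF assms, symmetric])
  also have "\<dots> = (\<Sum>v\<in>pverts T. deg T v ^ 3)"
    by (simp add: sum_arcs_tail_eq_sum_deg[OF assms] power2_eq_square power3_eq_cube mult.assoc)
  finally show ?thesis .
qed

section \<open>Relabelling the vertices\<close>

definition relabel :: "('a \<Rightarrow> 'b) \<Rightarrow> 'a pair_pre_digraph \<Rightarrow> 'b pair_pre_digraph" where
  "relabel f T = \<lparr>pverts = f ` pverts T, parcs = map_prod f f ` parcs T\<rparr>"

definition relabel_iso :: "('a \<Rightarrow> 'b) \<Rightarrow> ('a, 'a \<times> 'a, 'b, 'b \<times> 'b) digraph_isomorphism" where
  "relabel_iso f = \<lparr>iso_verts = f, iso_arcs = map_prod f f, iso_head = snd, iso_tail = fst\<rparr>"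

lemma with_proj_relabel: "with_proj (relabel f T) = app_iso (relabel_iso f) (with_proj T)"
  by (simp add: with_proj_def relabel_def relabel_iso_def app_iso_def)

lemma (in pair_wf_digraph) inj_on_map_prod_arcs:
  assumes "inj_on f (pverts G)"
  shows "inj_on (map_prod f f) (parcs G)"
proof (rule inj_onI, clarify)
  fix a b c d assume "(a, b) \<in> parcs G" "(c, d) \<in> parcs G" "map_prod f f (a, b) = map_prod f f (c, d)"
  then show "a = c \<and> b = d"
    using inj_onD[OF assms] in_arcsD1 in_arcsD2 by (metis map_prod_simp prod.inject)
qed

lemma digraph_isomorphism_relabel_iso:
  assumes "pair_wf_digraph T" "inj_on f (pverts T)"
  shows "pre_digraph.digraph_isomorphism (with_proj T) (relabel_iso f)"
  using assms pair_wf_digraph.inj_on_map_prod_arcs[OF assms]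
  by (auto simp: pre_digraph.digraph_isomorphism_def relabel_iso_def wf_digraph_wp_iff)

lemma (in wf_digraph) cycle_app_isoI:
  assumes "cycle p" and hom: "digraph_isomorphism hom"
  shows "pre_digraph.cycle (app_iso hom G) (map (iso_arcs hom) p)"
proof -
  from \<open>cycle p\<close> obtain u where
    u: "awalk u p u" "distinct (tl (awalk_verts u p))" "p \<noteq> []"
    by (auto simp: cycle_def)
  have "set (tl (awalk_verts u p)) \<subseteq> verts G"
    using awalk_verts_in_verts[of u p] u(1)
    by (meson awalk_def awalkE' list.set_sel(2) subset_iff awalk_verts_non_Nil)
  then have "inj_on (iso_verts hom) (set (tl (awalk_verts u p)))"
    using digraph_isomorphism_inj_on_verts[OF hom] by (rule inj_on_subset[rotated])
  then show ?thesis
    using u awalk_app_isoI[OF u(1) hom] awalk_verts_app_iso_eq[OF hom u(1)]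
    by (auto simp: pre_digraph.cycle_def distinct_map map_tl[symmetric]
        intro!: exI[of _ "iso_verts hom u"])
qed

text \<open>
  Connectedness is carried forward along the isomorphism, acyclicity backward: a long cycle of the
  relabelled graph is mapped by the inverse isomorphism to a cycle of the same length.
\<close>

lemma undirected_tree_relabel:
  assumes T: "undirected_tree T" and inj: "inj_on f (pverts T)"
  shows "undirected_tree (relabel f T)"
proof -
  interpret pair_graph T using T by (simp add: undirected_tree_def)
  have hom: "digraph_isomorphism (relabel_iso f)"
    by (rule digraph_isomorphism_relabel_iso[OF pair_wf_digraph_axioms inj])
  have graph: "pair_graph (relabel f T)"
  proof
    show "symmetric (with_proj (relabel f T))"
      using arcs_symmetric by (fastforce simp: symmetric_def relabel_def intro!: symI)
  next
    fix e assume "e \<in> parcs (relabel f T)"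
    then obtain u v where "e = (f u, f v)" "(u, v) \<in> parcs T"
      by (auto simp: relabel_def)
    then show "fst e \<noteq> snd e"
      using no_loops' inj by (auto dest!: inj_onD[OF inj] dest: in_arcsD1 in_arcsD2)
  qed (use pair_finite_arcs pair_finite_verts in
        \<open>auto simp: relabel_def dest: in_arcsD1 in_arcsD2\<close>)
  interpret H: pair_graph "relabel f T" by fact
  have conn: "connected (with_proj (relabel f T))"
    using T hom unfolding with_proj_relabel undirected_tree_def by (auto intro: connectedI_app_iso)
  have inv: "pre_digraph.digraph_isomorphism (app_iso (relabel_iso f) (with_proj T)) (inv_iso (relabel_iso f))"
    by (rule digraph_isomorphism_invI[OF hom])
  have "cycle (map (iso_arcs (inv_iso (relabel_iso f))) p)" if "H.cycle p" for p
    using H.cycle_app_isoI[OF that, unfolded with_proj_relabel, OF inv] app_iso_inv[OF hom] by simp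
  then show ?thesis
    using T graph conn unfolding undirected_tree_def by (metis length_map)
qed

lemma deg_relabel:
  assumes "pair_wf_digraph T" "inj_on f (pverts T)" "v \<in> pverts T"
  shows "deg (relabel f T) (f v) = deg T v"
  using wf_digraph.out_degree_app_iso_eq[OF _ digraph_isomorphism_relabel_iso[OF assms(1,2)], of v] assms
  by (simp add: deg_def with_proj_relabel wf_digraph_wp_iff relabel_iso_def)

lemma max_deg_relabel:
  assumes "pair_wf_digraph T" "inj_on f (pverts T)"
  shows "max_deg (relabel f T) = max_deg T"
proof -
  have "deg (relabel f T) ` f ` pverts T = deg T ` pverts T"
    using deg_relabel[OF assms] by (auto simp: image_image)
  then show ?thesis by (simp add: max_deg_def relabel_def)
qed

text \<open>
  Relabelling need not respect the order of the vertices and so permutes the two representatives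
  of an edge. The sum over all arcs counts both of them and is invariant.
\<close>

lemma sigma_relabel:
  assumes T: "pair_graph T" and fT: "pair_graph (relabel f T)" and inj: "inj_on f (pverts T)"
  shows "sigma (relabel f T) = sigma T"
proof -
  have arcs: "2 * sigma G = (\<Sum>(u, v)\<in>parcs G. (deg G u - deg G v)\<^sup>2)"
    if "pair_graph G" for G :: "'c::linorder pair_pre_digraph"
    unfolding sum_arcs_eq_sum_edges[OF that] sigma_def sum_distrib_left
    by (intro sum.cong) (auto simp: power2_commute)
  interpret pair_graph T by fact
  note wf = pair_wf_digraph_axioms
  have parcs_relabel: "parcs (relabel f T) = map_prod f f ` parcs T"
    by (simp add: relabel_def)
  have "2 * sigma (relabel f T)
      = (\<Sum>(u, v)\<in>map_prod f f ` parcs T. (deg (relabel f T) u - deg (relabel f T) v)\<^sup>2)"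
    using arcs[OF fT] by (simp only: parcs_relabel)
  also have "\<dots> = (\<Sum>(u, v)\<in>parcs T. (deg T u - deg T v)\<^sup>2)"
    by (subst sum.reindex[OF inj_on_map_prod_arcs[OF inj]])
      (auto intro!: sum.cong simp: deg_relabel[OF wf inj in_arcsD1] deg_relabel[OF wf inj in_arcsD2])
  also have "\<dots> = 2 * sigma T" by (simp add: arcs[OF T])
  finally show ?thesis by simp
qed

lemma sigma_image_standard_vertices:
  fixes n :: nat and m :: int
  shows "sigma ` {T :: nat pair_pre_digraph. undirected_tree T \<and> card (pverts T) = n \<and> max_deg T = m}
       = sigma ` {T. undirected_tree T \<and> pverts T = {..<n} \<and> max_deg T = m}"
    (is "_ ` ?S = _ ` ?R")
proof
  show "sigma ` ?S \<subseteq> sigma ` ?R"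
  proof (rule image_subsetI)
    fix T assume "T \<in> ?S"
    then have T: "undirected_tree T" "card (pverts T) = n" "max_deg T = m" by auto
    interpret pair_graph T using T(1) by (simp add: undirected_tree_def)
    obtain f where f: "bij_betw f (pverts T) {..<n}"
      using ex_bij_betw_finite_nat[OF pair_finite_verts] T(2) by (auto simp: atLeast0LessThan)
    then have inj: "inj_on f (pverts T)" by (rule bij_betw_imp_inj_on)
    have tree: "undirected_tree (relabel f T)"
      by (rule undirected_tree_relabel[OF T(1) inj])
    have "relabel f T \<in> ?R"
      using f tree T(3) max_deg_relabel[OF pair_wf_digraph_axioms inj]
      by (auto simp: relabel_def bij_betw_def)
    moreover have "sigma T = sigma (relabel f T)"
      using sigma_relabel[OF pair_graph _ inj] tree by (simp add: undirected_tree_def)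
    ultimately show "sigma T \<in> sigma ` ?R" by blast
  qed
qed auto

section \<open>Grouping the trees by degree sequence\<close>

lemma deg_pos:
  assumes T: "undirected_tree T" and v: "v \<in> pverts T" and card: "card (pverts T) \<ge> 2"
  shows "deg T v \<ge> 1"
proof -
  interpret pair_graph T using T by (simp add: undirected_tree_def)
  obtain w where w: "w \<in> pverts T" "w \<noteq> v"
    using card v by (metis card_2_iff' card_le_Suc0_iff_eq not_less_eq_eq numeral_2_eq_2 pair_finite_verts)
  have "strongly_connected (with_proj T)"
    using T pair_sym_arcs by (auto simp: undirected_tree_def intro: symmetric_connected_imp_strongly_connected)
  then obtain p where "awalk v p w"
    using v w(1) by (auto simp: strongly_connected_def reachable_awalk)
  then obtain e where "e \<in> out_arcs (with_proj T) v"
    using w(2) by (cases p) (auto simp: awalk_simps)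
  then have "card (out_arcs (with_proj T) v) \<noteq> 0"
    using finite_out_arcs by auto
  then show ?thesis by (simp add: deg_def out_degree_def)
qed

text \<open>
  A degree sequence must have positive entries. This is where two or more vertices are needed: the
  tree with a single vertex has the degree sequence \<open>[0]\<close>.
\<close>

lemma trees_eq_Union_realizations:
  assumes "n \<ge> 2"
  shows "{T. undirected_tree T \<and> pverts T = {..<n} \<and> max_deg T = int \<Delta>}
       = (\<Union>d\<in>tree_degree_sequences n \<Delta>. realizations d)"
proof (intro set_eqI iffI)
  fix T assume "T \<in> {T. undirected_tree T \<and> pverts T = {..<n} \<and> max_deg T = int \<Delta>}"
  then have T: "undirected_tree T" "pverts T = {..<n}" "max_deg T = int \<Delta>" by auto
  define d where "d = map (deg T) [0..<n]"
  have "T \<in> realizations d"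
    using T by (simp add: realizations_def d_def)
  moreover have "1 \<le> d ! i \<and> d ! i \<le> int \<Delta>" if "i < n" for i
  proof -
    have "deg T i \<le> Max (deg T ` {..<n})" using that by (intro Max_ge) auto
    then have "deg T i \<le> int \<Delta>" using T by (simp add: max_deg_def)
    then show ?thesis
      using that deg_pos[OF T(1), of i] T(2) assms by (simp add: d_def)
  qed
  moreover have "Max (set d) = int \<Delta>"
    using T by (simp add: d_def max_deg_def atLeast0LessThan)
  ultimately have "d \<in> tree_degree_sequences n \<Delta>"
    by (auto simp: tree_degree_sequences_def d_def)
  with \<open>T \<in> realizations d\<close> show "T \<in> (\<Union>d\<in>tree_degree_sequences n \<Delta>. realizations d)"
    by blast
next
  fix T assume "T \<in> (\<Union>d\<in>tree_degree_sequences n \<Delta>. realizations d)"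
  then obtain d where d: "d \<in> tree_degree_sequences n \<Delta>" "T \<in> realizations d" by blast
  have "set d = deg T ` {..<n}"
    using d by (auto simp: set_conv_nth tree_degree_sequences_def realizations_def)
  then show "T \<in> {T. undirected_tree T \<and> pverts T = {..<n} \<and> max_deg T = int \<Delta>}"
    using d by (auto simp: tree_degree_sequences_def realizations_def max_deg_def)
qed

lemma finite_realizations: "finite (realizations d)"
proof -
  let ?V = "{..<length d}"
  have "realizations d \<subseteq> pair_pre_digraph.make ?V ` Pow (?V \<times> ?V)"
  proof
    fix T assume "T \<in> realizations d"
    then have T: "undirected_tree T" "pverts T = ?V" by (auto simp: realizations_def)
    interpret pair_graph T using T(1) by (simp add: undirected_tree_def)
    have "parcs T \<subseteq> ?V \<times> ?V" using in_arcsD1 in_arcsD2 T(2) by auto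
    moreover have "T = pair_pre_digraph.make ?V (parcs T)"
      using T(2) by (simp add: pair_pre_digraph.make_def)
    ultimately show "T \<in> pair_pre_digraph.make ?V ` Pow (?V \<times> ?V)" by blast
  qed
  then show ?thesis by (rule finite_subset) simp
qed

lemma finite_tree_degree_sequences: "finite (tree_degree_sequences n \<Delta>)"
proof -
  have "tree_degree_sequences n \<Delta> \<subseteq> {d. set d \<subseteq> {1..int \<Delta>} \<and> length d = n}"
    by (auto simp: tree_degree_sequences_def in_set_conv_nth)
  then show ?thesis
    by (rule finite_subset) (rule finite_lists_length_eq, simp)
qed

lemma Max_sigma_realizations:
  assumes ne: "realizations d \<noteq> {}"
  shows "Max (sigma ` realizations d) = F d - 2 * M2_min d"
proof -
  have sigma: "sigma T = F d - 2 * M2 T" if "T \<in> realizations d" for T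
    using that sigma_eq_sum_cubes_minus_M2[of T]
    by (simp add: realizations_def undirected_tree_def F_def)
  have "M2_min d \<in> M2 ` realizations d"
    unfolding M2_min_def using ne finite_realizations by (intro Min_in) auto
  then have "F d - 2 * M2_min d \<in> sigma ` realizations d"
    using sigma by force
  moreover have "sigma T \<le> F d - 2 * M2_min d" if "T \<in> realizations d" for T
    using that sigma finite_realizations by (simp add: M2_min_def)
  ultimately show ?thesis
    using finite_realizations by (intro Max_eqI) auto
qed

lemma Max_image_UNION:
  assumes "finite I" "\<And>i. i \<in> I \<Longrightarrow> finite (A i)" "\<And>i. i \<in> I \<Longrightarrow> A i \<noteq> {}"
  shows "Max (f ` (\<Union>i\<in>I. A i)) = Max ((\<lambda>i. Max (f ` A i)) ` I)"
proof (cases "I = {}")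
  case False
  let ?m = "Max ((\<lambda>i. Max (f ` A i)) ` I)"
  have "?m \<in> (\<lambda>i. Max (f ` A i)) ` I"
    using assms(1) False by (intro Max_in) auto
  then obtain i where i: "i \<in> I" "?m = Max (f ` A i)" by blast
  have "Max (f ` A i) \<in> f ` A i"
    using assms(2,3) i(1) by (intro Max_in) auto
  then have "?m \<in> f ` (\<Union>i\<in>I. A i)"
    using i by auto
  moreover have "f x \<le> ?m" if "j \<in> I" "x \<in> A j" for j x
  proof -
    have "f x \<le> Max (f ` A j)" using assms(2) that by simp
    also have "\<dots> \<le> ?m" using assms(1) that(1) by simp
    finally show ?thesis .
  qed
  ultimately show ?thesis
    using assms(1,2) by (intro Max_eqI) auto
qed simp

theorem proposition3p1:
  fixes n \<Delta> :: nat
  assumes "n \<ge> \<Delta> + 1" and "\<Delta> + 1 \<ge> 4"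
  shows "sigma_max n \<Delta> = Max ((\<lambda>d. F d - 2 * M2_min d) ` tree_degree_sequences n \<Delta>)"
proof -
  let ?D = "tree_degree_sequences n \<Delta>"
  have "n \<ge> 2" using assms by simp
  have ne: "realizations d \<noteq> {}" if "d \<in> ?D" for d
    using that by (simp add: tree_degree_sequences_def)
  have "sigma_max n \<Delta> = Max (sigma ` (\<Union>d\<in>?D. realizations d))"
    unfolding sigma_max_def sigma_image_standard_vertices trees_eq_Union_realizations[OF \<open>n \<ge> 2\<close>] ..
  also have "\<dots> = Max ((\<lambda>d. Max (sigma ` realizations d)) ` ?D)"
    using finite_tree_degree_sequences finite_realizations ne by (intro Max_image_UNION) auto
  also have "(\<lambda>d. Max (sigma ` realizations d)) ` ?D = (\<lambda>d. F d - 2 * M2_min d) ` ?D"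
    using ne by (intro image_cong) (auto simp: Max_sigma_realizations)
  finally show ?thesis .
qed

end
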